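(* Let $R$ be a commutative ring, let $\mathfrak{a}$ be an ideal of $R$, and let $R \to S$ be a homomorphism of commutative rings making $S$ a content algebra over $R$. Then \[ \mathrm{sK}_S(S/\mathfrak{a} S) = \{\mathfrak{p} S \mid \mathfrak{p} \in \mathrm{sK}_R(R/\mathfrak{a})\} = \bigcup_{\mathfrak{p} \in \mathrm{sK}_R(R/\mathfrak{a})} \mathrm{sK}_S(S/\mathfrak{p} S). \]
   Context: All rings are commutative with unity and not necessarily Noetherian. For a ring $A$ and an $A$-module $N$, the set $\mathrm{sK}_A(N)$ of strong Krull primes of $N$ is the set of all $\mathfrak{p} \in \mathrm{Spec}\, A$ such that for every finitely generated ideal $I$ of $A$ with $I \subseteq \mathfrak{p}$ there is an element $z \in N$ with $I \subseteq \mathrm{ann}_A(z) \subseteq \mathfrak{p}$. For a ring homomorphism $R \to S$, the content map $c$ from $S$ to the set of ideals of $R$ is defined by $c(f) := \bigcap\{I \mid I \text{ is an ideal of } R \text{ such that } f \in IS\}$. One says that $S$ is a content algebra over $R$ if the following four axioms hold: (1) for all $f \in S$, $f \in c(f)S$; (2) for all $f \in S$ and $r \in R$, $c(rf) = r\,c(f)$; (3) $c(1) = R$; (4) (Dedekind–Mertens property) for all $f, g \in S$ there exists $n \in \mathbb{N}$ such that $c(f)^n c(fg) = c(f)^{n+1} c(g)$. *)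

theory Defs
  imports "HOL-Algebra.QuotRing" "HOL-Algebra.Ideal_Product" "HOL-Algebra.Module"
begin

section \<open>Quotients as modules, and strong Krull primes\<close>

text \<open>
  The quotient \<open>A/I\<close> as an \<open>A\<close>-module: the quotient ring of the library together with the scalar
  action \<open>r \<cdot> (x + I) = r x + I\<close>, written as multiplication by the coset of \<open>r\<close>.
\<close>

definition quot_module :: "('a, 'm) ring_scheme \<Rightarrow> 'a set \<Rightarrow> ('a, 'a set) module"
  where "quot_module A I =
    \<lparr>carrier = carrier (A Quot I), mult = mult (A Quot I), one = one (A Quot I),
     zero = zero (A Quot I), add = add (A Quot I),
     smult = (\<lambda>r C. (I +>\<^bsub>A\<^esub> r) \<otimes>\<^bsub>A Quot I\<^esub> C)\<rparr>"

lemma quot_module_sel [simp]: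
  "carrier (quot_module A I) = carrier (A Quot I)"
  "mult (quot_module A I) = mult (A Quot I)"
  "one (quot_module A I) = one (A Quot I)"
  "zero (quot_module A I) = zero (A Quot I)"
  "add (quot_module A I) = add (A Quot I)"
  by (simp_all add: quot_module_def)

lemma quot_module_smult:
  assumes "ideal I A" "r \<in> carrier A" "x \<in> carrier A"
  shows "r \<odot>\<^bsub>quot_module A I\<^esub> (I +>\<^bsub>A\<^esub> x) = I +>\<^bsub>A\<^esub> (r \<otimes>\<^bsub>A\<^esub> x)"
  using ideal.rcoset_mult_add[OF assms] by (simp add: quot_module_def FactRing_def)

lemma module_quot_module:
  assumes "cring A" "ideal I A"
  shows "module A (quot_module A I)"
proof -
  interpret A: cring A by fact
  interpret I: ideal I A by fact
  interpret Q: cring "A Quot I" by (rule I.quotient_is_cring[OF assms(1)])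
  interpret p: ring_hom_ring A "A Quot I" "(+>\<^bsub>A\<^esub>) I" by (rule I.rcos_ring_hom_ring)
  have "abelian_group (quot_module A I)"
    by (rule abelian_groupI) (auto simp: Q.add.m_ac intro: Q.add.l_inv_ex)
  then show ?thesis
    by (intro moduleI[OF assms(1)])
       (simp_all add: quot_module_def Q.l_distr Q.r_distr Q.m_assoc)
qed

definition annihilator :: "('a, 'm) ring_scheme \<Rightarrow> ('a, 'b, 'n) module_scheme \<Rightarrow> 'b \<Rightarrow> 'a set"
  where "annihilator A N z = {r \<in> carrier A. r \<odot>\<^bsub>N\<^esub> z = \<zero>\<^bsub>N\<^esub>}"

definition fg_ideal :: "'a set \<Rightarrow> ('a, 'm) ring_scheme \<Rightarrow> bool"
  where "fg_ideal I A \<longleftrightarrow> (\<exists>G \<subseteq> carrier A. finite G \<and> I = Idl\<^bsub>A\<^esub> G)"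

definition strong_Krull :: "('a, 'm) ring_scheme \<Rightarrow> ('a, 'b, 'n) module_scheme \<Rightarrow> 'a set set"
  where "strong_Krull A N =
    {p. primeideal p A \<and>
        (\<forall>I. fg_ideal I A \<and> I \<subseteq> p \<longrightarrow>
          (\<exists>z \<in> carrier N. I \<subseteq> annihilator A N z \<and> annihilator A N z \<subseteq> p))}"


section \<open>Content algebras\<close>

definition ideal_ext :: "('b, 'n) ring_scheme \<Rightarrow> ('a \<Rightarrow> 'b) \<Rightarrow> 'a set \<Rightarrow> 'b set"
  where "ideal_ext S h I = Idl\<^bsub>S\<^esub> (h ` I)"

definition content ::
    "('a, 'm) ring_scheme \<Rightarrow> ('b, 'n) ring_scheme \<Rightarrow> ('a \<Rightarrow> 'b) \<Rightarrow> 'b \<Rightarrow> 'a set"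
  where "content R S h f = \<Inter>{I. ideal I R \<and> f \<in> ideal_ext S h I}"

text \<open>
  In the axioms below, \<open>r <#\<^bsub>R\<^esub> I\<close> is the set \<open>{r x | x \<in> I}\<close>, \<open>\<cdot>\<^bsub>R\<^esub>\<close> is the product of ideals, and powers
  of ideals are taken in the multiplicative monoid of \<open>ideals_set R\<close>, so that \<open>I\<^sup>0 = R\<close>.
\<close>

locale content_algebra = ring_hom_cring R S h
  for R :: "('a, 'm) ring_scheme" (structure)
    and S :: "('b, 'n) ring_scheme" (structure)
    and h :: "'a \<Rightarrow> 'b" +
  assumes mem_content_ext:
      "f \<in> carrier S \<Longrightarrow> f \<in> ideal_ext S h (content R S h f)"
    and content_smult:
      "\<lbrakk>f \<in> carrier S; r \<in> carrier R\<rbrakk>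
        \<Longrightarrow> content R S h (h r \<otimes>\<^bsub>S\<^esub> f) = r <#\<^bsub>R\<^esub> content R S h f"
    and content_one:
      "content R S h \<one>\<^bsub>S\<^esub> = carrier R"
    and Dedekind_Mertens:
      "\<lbrakk>f \<in> carrier S; g \<in> carrier S\<rbrakk>
        \<Longrightarrow> \<exists>n::nat.
              (content R S h f [^]\<^bsub>ideals_set R\<^esub> n) \<cdot>\<^bsub>R\<^esub> content R S h (f \<otimes>\<^bsub>S\<^esub> g)
              = (content R S h f [^]\<^bsub>ideals_set R\<^esub> (n + 1)) \<cdot>\<^bsub>R\<^esub> content R S h g"

end

theory Submission
  imports Defs
begin

text \<open>
  The content detects extended ideals: \<open>f \<in> IS\<close> iff \<open>c(f) \<subseteq> I\<close>. Hence for \<open>z \<in> R\<close> the ideal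
  \<open>(\<aa>S : z)\<close> is the extension of \<open>(\<aa> : z)\<close>, which transports witnesses for strong Krull primes
  from \<open>R\<close> to \<open>S\<close>. Conversely, let \<open>Q\<close> be a strong Krull prime of \<open>S/\<aa>S\<close>. If \<open>f \<in> Q\<close>, choose \<open>g\<close>
  with \<open>fg \<in> \<aa>S\<close> and \<open>(\<aa>S : g) \<subseteq> Q\<close>; the Dedekind--Mertens property puts a power of each element of
  \<open>c(f)\<close> into \<open>(\<aa>S : g) \<subseteq> Q\<close>, so that \<open>c(f) \<subseteq> Q \<inter> R\<close> and \<open>Q\<close> is the extension of \<open>Q \<inter> R\<close>. A witness
  \<open>g\<close> in \<open>S\<close> yields one in \<open>R\<close> because \<open>c(g)\<close> is finitely generated, say by \<open>z\<^sub>1, \<dots>, z\<^sub>k\<close>: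
  the prime \<open>Q \<inter> R\<close> contains \<open>(\<aa> : c(g)) = (\<aa> : z\<^sub>1) \<inter> \<dots> \<inter> (\<aa> : z\<^sub>k)\<close>, hence some \<open>(\<aa> : z\<^sub>i)\<close>.
\<close>

section \<open>Ideals of commutative rings\<close>

lemma (in cring) ideal_colon:
  assumes "ideal I R" "x \<in> carrier R"
  shows "ideal {r \<in> carrier R. r \<otimes> x \<in> I} R"
proof -
  interpret I: ideal I R by fact
  show ?thesis
  proof (intro idealI ring_axioms add.subgroupI)
    show "{r \<in> carrier R. r \<otimes> x \<in> I} \<noteq> {}"
      using assms(2) I.zero_closed l_null by (metis (lifting) CollectI empty_iff zero_closed)
  next
    fix a y assume "a \<in> {r \<in> carrier R. r \<otimes> x \<in> I}" and y: "y \<in> carrier R"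
    then have a: "a \<in> carrier R" "a \<otimes> x \<in> I" by auto
    then have "y \<otimes> a \<otimes> x \<in> I"
      using I.I_l_closed[OF a(2) y] y assms(2) by (simp add: m_assoc)
    then show "y \<otimes> a \<in> {r \<in> carrier R. r \<otimes> x \<in> I}"
      and "a \<otimes> y \<in> {r \<in> carrier R. r \<otimes> x \<in> I}"
      using a(1) y by (simp_all add: m_comm)
  qed (use assms(2) in \<open>auto simp: l_minus l_distr\<close>)
qed

text \<open>The elements that need only finitely many generators form an ideal, because two finite
  subsets of \<open>X\<close> have a finite union in \<open>X\<close>. This finiteness is what makes
  contents finitely generated later.\<close>

lemma (in ring) mem_genideal_finite:
  assumes "X \<subseteq> carrier R" "f \<in> Idl X"
  obtains G where "finite G" "G \<subseteq> X" "f \<in> Idl G"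
proof -
  define U where "U = {f. \<exists>G. finite G \<and> G \<subseteq> X \<and> f \<in> Idl G}"
  have ideal_Idl: "ideal (Idl G) R" if "G \<subseteq> X" for G
    using that assms(1) by (intro genideal_ideal) blast
  have UI: "f \<in> U" if "finite G" "G \<subseteq> X" "f \<in> Idl G" for f G
    using that unfolding U_def by blast
  have "ideal U R"
  proof (intro idealI ring_axioms add.subgroupI)
    show "U \<subseteq> carrier R"
      unfolding U_def using ideal_Idl by (auto dest: ideal.Icarr)
    show "U \<noteq> {}"
      using UI[of "{}" \<zero>] ideal_Idl[of "{}"]
      by (auto intro: additive_subgroup.zero_closed ideal.axioms(1))
  next
    fix a b assume "a \<in> U" "b \<in> U"
    then obtain G H where G: "finite G" "G \<subseteq> X" "a \<in> Idl G"
      and H: "finite H" "H \<subseteq> X" "b \<in> Idl H"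
      unfolding U_def by blast
    have "Idl G \<subseteq> Idl (G \<union> H)" "Idl H \<subseteq> Idl (G \<union> H)"
      using G(2) H(2) assms(1) by (auto intro!: subset_Idl_subset del: subsetI)
    then have "a \<oplus> b \<in> Idl (G \<union> H)"
      using G H ideal_Idl[of "G \<union> H"]
      by (intro additive_subgroup.a_closed ideal.axioms(1)) auto
    then show "a \<oplus> b \<in> U"
      using G H by (intro UI[of "G \<union> H"]) auto
  next
    fix a assume "a \<in> U"
    then obtain G where G: "finite G" "G \<subseteq> X" "a \<in> Idl G"
      unfolding U_def by blast
    interpret G: ideal "Idl G" R using G(2) by (rule ideal_Idl)
    show "\<ominus> a \<in> U"
      using G by (intro UI[of G]) simp_all
    fix x assume "x \<in> carrier R"
    then show "x \<otimes> a \<in> U" "a \<otimes> x \<in> U"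
      using G G.I_l_closed G.I_r_closed by (auto intro!: UI[of G])
  qed
  moreover have "X \<subseteq> U"
  proof
    fix x assume "x \<in> X"
    then show "x \<in> U"
      using assms(1) by (intro UI[of "{x}"] genideal_self') auto
  qed
  ultimately have "Idl X \<subseteq> U"
    by (rule genideal_minimal)
  then show thesis
    using assms(2) that unfolding U_def by blast
qed

lemma (in primeideal) mem_of_pow_mem:
  assumes "x \<in> carrier R" "x [^] (n::nat) \<in> I"
  shows "x \<in> I"
  using assms(2)
proof (induction n)
  case 0
  then show ?case using I_notcarr one_imp_carrier by simp
next
  case (Suc n)
  then show ?case using I_prime[of "x [^] n" x] assms(1) by auto
qed

lemma (in primeideal) prod_not_mem:
  assumes "finite A" "\<And>a. a \<in> A \<Longrightarrow> f a \<in> carrier R - I"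
  shows "(\<Otimes>a\<in>A. f a) \<in> carrier R - I"
  using assms
proof (induction A rule: finite_induct)
  case empty
  then show ?case using I_notcarr one_imp_carrier by auto
next
  case (insert a A)
  then have "f \<in> A \<rightarrow> carrier R" by auto
  then show ?case using insert I_prime[of "f a" "\<Otimes>a\<in>A. f a"] by auto
qed

lemma (in cring) ideal_pow:
  assumes "ideal I R"
  shows "ideal (I [^]\<^bsub>ideals_set R\<^esub> (n::nat)) R"
proof (induction n)
  case 0
  then show ?case by (simp add: ideals_set_def oneideal)
next
  case (Suc n)
  then show ?case using assms ideal_prod_is_ideal
    by (simp add: nat_pow_def ideals_set_def)
qed

lemma (in cring) pow_mem_ideal_pow:
  assumes "ideal I R" "x \<in> I"
  shows "x [^] (n::nat) \<in> I [^]\<^bsub>ideals_set R\<^esub> n"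
proof (induction n)
  case 0
  then show ?case by (simp add: ideals_set_def)
next
  case (Suc n)
  then show ?case using assms ideal_prod.prod
    by (fastforce simp: nat_pow_def ideals_set_def)
qed

section \<open>Strong Krull primes of a quotient, in terms of elements\<close>

lemma (in cring) annihilator_quot_module:
  assumes "ideal I R" "x \<in> carrier R"
  shows "annihilator R (quot_module R I) (I +> x) = {r \<in> carrier R. r \<otimes> x \<in> I}"
  using assms
  by (auto simp: annihilator_def quot_module_smult FactRing_def a_rcos_zero
      intro: ideal.rcos_const_imp_mem)

text \<open>An ideal contains \<open>Idl G\<close> as soon as it contains \<open>G\<close>, and the
  annihilator of the coset of \<open>x\<close> is the colon ideal (I : x). All later arguments use
  this form, free of cosets and of generated ideals.\<close>

lemma (in cring) mem_strong_Krull_quot_module_iff: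
  assumes I: "ideal I R"
  shows "p \<in> strong_Krull R (quot_module R I) \<longleftrightarrow>
    primeideal p R \<and>
    (\<forall>G. finite G \<and> G \<subseteq> p \<longrightarrow>
      (\<exists>x\<in>carrier R. (\<forall>r\<in>G. r \<otimes> x \<in> I) \<and> (\<forall>r\<in>carrier R. r \<otimes> x \<in> I \<longrightarrow> r \<in> p)))"
    (is "_ \<longleftrightarrow> _ \<and> (\<forall>G. _ \<longrightarrow> ?W G)")
proof -
  have carrier: "carrier (R Quot I) = (+>) I ` carrier R"
    by (auto simp: FactRing_def A_RCOSETS_def')
  have W: "(\<exists>z\<in>carrier (quot_module R I). Idl G \<subseteq> annihilator R (quot_module R I) z \<and>
      annihilator R (quot_module R I) z \<subseteq> p) \<longleftrightarrow> ?W G" if G: "G \<subseteq> carrier R" for G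
  proof -
    have "Idl G \<subseteq> {r \<in> carrier R. r \<otimes> x \<in> I} \<longleftrightarrow> (\<forall>r\<in>G. r \<otimes> x \<in> I)" if "x \<in> carrier R" for x
      using Idl_subset_ideal[OF ideal_colon[OF I that] G] G by blast
    then show ?thesis
      by (auto simp: carrier annihilator_quot_module[OF I] subset_iff)
  qed
  show ?thesis
  proof (cases "primeideal p R")
    case True
    then interpret p: primeideal p R .
    have fg: "(\<forall>J. fg_ideal J R \<and> J \<subseteq> p \<longrightarrow> V J) \<longleftrightarrow>
        (\<forall>G. G \<subseteq> carrier R \<and> finite G \<and> Idl G \<subseteq> p \<longrightarrow> V (Idl G))" for V
      by (auto simp: fg_ideal_def)
    have "(\<forall>J. fg_ideal J R \<and> J \<subseteq> p \<longrightarrow> (\<exists>z\<in>carrier (quot_module R I).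
        J \<subseteq> annihilator R (quot_module R I) z \<and> annihilator R (quot_module R I) z \<subseteq> p))
      \<longleftrightarrow> (\<forall>G. G \<subseteq> carrier R \<and> finite G \<and> Idl G \<subseteq> p \<longrightarrow> ?W G)"
      unfolding fg by (intro all_cong1 imp_cong refl W) simp
    also have "\<dots> \<longleftrightarrow> (\<forall>G. finite G \<and> G \<subseteq> p \<longrightarrow> ?W G)"
    proof -
      have "G \<subseteq> carrier R \<and> finite G \<and> Idl G \<subseteq> p \<longleftrightarrow> finite G \<and> G \<subseteq> p" for G
        using Idl_subset_ideal[OF p.is_ideal, of G] p.a_subset by auto
      then show ?thesis by simp
    qed
    finally show ?thesis
      using True by (simp add: strong_Krull_def)
  qed (simp add: strong_Krull_def)
qed

text \<open>For \<open>x\<close> outside a prime \<open>p\<close> the colon ideal (p : x) is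
  \<open>p\<close> itself. This turns each member of the union in the theorem into a
  singleton.\<close>

lemma (in cring) strong_Krull_quot_primeideal:
  assumes "primeideal p R"
  shows "strong_Krull R (quot_module R p) = {p}"
proof -
  interpret p: primeideal p R by fact
  have "q = p" if "q \<in> strong_Krull R (quot_module R p)" for q
  proof
    have q: "primeideal q R" and W: "\<And>G. finite G \<Longrightarrow> G \<subseteq> q \<Longrightarrow>
        \<exists>x\<in>carrier R. (\<forall>r\<in>G. r \<otimes> x \<in> p) \<and> (\<forall>r\<in>carrier R. r \<otimes> x \<in> p \<longrightarrow> r \<in> q)"
      using that unfolding mem_strong_Krull_quot_module_iff[OF p.is_ideal] by auto
    interpret q: primeideal q R by fact
    show "p \<subseteq> q"
      \<comment> \<open>Even the empty set has a witness \<open>x\<close>, and \<open>p\<close> is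
        contained in (p : x), hence in \<open>q\<close>.\<close>
      using W[of "{}"] p.I_r_closed p.Icarr by auto
    show "q \<subseteq> p"
    proof
      fix y assume y: "y \<in> q"
      then obtain x where x: "x \<in> carrier R" "y \<otimes> x \<in> p" "\<forall>r\<in>carrier R. r \<otimes> x \<in> p \<longrightarrow> r \<in> q"
        using W[of "{y}"] by auto
      \<comment> \<open>Otherwise \<open>\<one>\<close> would lie in (p : x) and so in the proper
        ideal \<open>q\<close>.\<close>
      have "x \<notin> p"
        using x(1,3) q.one_imp_carrier q.I_notcarr by (metis l_one one_closed)
      then show "y \<in> p"
        using p.I_prime[of y x] x y q.Icarr by blast
    qed
  qed
  moreover have "p \<in> strong_Krull R (quot_module R p)"
    unfolding mem_strong_Krull_quot_module_iff[OF p.is_ideal]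
    \<comment> \<open>The witness \<open>\<one>\<close> serves every finite set, since (p : 1) =
      p.\<close>
    using assms p.Icarr by (auto intro!: bexI[of _ \<one>])
  ultimately show ?thesis by blast
qed


section \<open>Extension and contraction along a content algebra\<close>

context content_algebra
begin

abbreviation ext where "ext \<equiv> ideal_ext S h"
abbreviation cont where "cont \<equiv> content R S h"

lemma image_subset_carrier: "X \<subseteq> carrier R \<Longrightarrow> h ` X \<subseteq> carrier S"
  by auto

lemma ideal_subset_carrier: "ideal I R \<Longrightarrow> I \<subseteq> carrier R"
  by (auto dest: ideal.Icarr)

lemma ext_ideal: "ideal I R \<Longrightarrow> ideal (ext I) S"
  unfolding ideal_ext_def
  by (intro S.genideal_ideal image_subset_carrier ideal_subset_carrier)

lemma ext_subset_iff:
  assumes "ideal I R" "ideal J S"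
  shows "ext I \<subseteq> J \<longleftrightarrow> h ` I \<subseteq> J"
  unfolding ideal_ext_def using assms
  by (intro S.Idl_subset_ideal image_subset_carrier ideal_subset_carrier)

lemma image_subset_ext: "ideal I R \<Longrightarrow> h ` I \<subseteq> ext I"
  using ext_subset_iff ext_ideal by blast

lemma ext_mono: "\<lbrakk>ideal I R; ideal J R; I \<subseteq> J\<rbrakk> \<Longrightarrow> ext I \<subseteq> ext J"
  using ext_subset_iff[of I "ext J"] ext_ideal image_subset_ext by blast

lemma ext_carrier: "ext (carrier R) = carrier S"
  using image_subset_ext[OF R.oneideal] ideal.one_imp_carrier[OF ext_ideal[OF R.oneideal]]
  by (metis R.one_closed hom_one image_subset_iff)

section \<open>Content ideals\<close>

lemma content_ideal:
  assumes "f \<in> carrier S"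
  shows "ideal (cont f) R"
  unfolding content_def
  \<comment> \<open>The intersected family must be nonempty; it contains the unit ideal, which
    extends to \<open>carrier S\<close>.\<close>
  using assms R.oneideal by (intro R.i_Intersect) (auto simp: ext_carrier)

text \<open>One direction is the minimality of the intersection, the other the axiom that
  \<open>f\<close> lies in the extension of its content. It moves membership questions in
  \<open>S\<close> to inclusions of ideals of \<open>R\<close>.\<close>

lemma mem_ext_iff:
  assumes "ideal I R" "f \<in> carrier S"
  shows "f \<in> ext I \<longleftrightarrow> cont f \<subseteq> I"
proof
  show "f \<in> ext I \<Longrightarrow> cont f \<subseteq> I"
    unfolding content_def using assms(1) by blast
  show "cont f \<subseteq> I \<Longrightarrow> f \<in> ext I"
    using ext_mono[OF content_ideal[OF assms(2)] assms(1)] mem_content_ext[OF assms(2)] by blast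
qed

lemma smult_mem_ext_iff:
  assumes "ideal I R" "x \<in> carrier R" "g \<in> carrier S"
  shows "h x \<otimes>\<^bsub>S\<^esub> g \<in> ext I \<longleftrightarrow> (\<forall>y\<in>cont g. x \<otimes> y \<in> I)"
  using assms by (auto simp: mem_ext_iff content_smult l_coset_def)

text \<open>Only finitely many elements of \<open>cont f\<close> are needed to express
  \<open>f\<close> in the extension of \<open>cont f\<close>. By minimality of the content, the
  ideal they generate is already all of \<open>cont f\<close>.\<close>

lemma content_finitely_generated:
  assumes f: "f \<in> carrier S"
  obtains G where "finite G" "G \<subseteq> carrier R" "cont f = Idl\<^bsub>R\<^esub> G"
proof -
  have sub: "cont f \<subseteq> carrier R"
    using f by (intro ideal_subset_carrier content_ideal)
  obtain H where H: "finite H" "H \<subseteq> h ` cont f" "f \<in> Idl\<^bsub>S\<^esub> H"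
    using mem_content_ext[OF f] S.mem_genideal_finite[OF image_subset_carrier[OF sub]]
    unfolding ideal_ext_def by blast
  obtain G where G: "finite G" "G \<subseteq> cont f" "H = h ` G"
    using finite_subset_image[OF H(1,2)] by blast
  have GR: "G \<subseteq> carrier R" using G(2) sub by blast
  have idG: "ideal (Idl\<^bsub>R\<^esub> G) R"
    using GR by (rule R.genideal_ideal)
  have "H \<subseteq> ext (Idl\<^bsub>R\<^esub> G)"
    using image_subset_ext[OF idG] R.genideal_self[OF GR] G(3) by blast
  then have "f \<in> ext (Idl\<^bsub>R\<^esub> G)"
    using S.genideal_minimal[OF ext_ideal[OF idG]] H(3) by blast
  then have "cont f \<subseteq> Idl\<^bsub>R\<^esub> G"
    using mem_ext_iff[OF idG f] by simp
  moreover have "Idl\<^bsub>R\<^esub> G \<subseteq> cont f"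
    using R.genideal_minimal[OF content_ideal[OF f] G(2)] .
  ultimately show thesis using that G(1) GR by blast
qed

text \<open>The Dedekind-Mertens equation places c(f)^(n+1) c(g) inside c(fg), hence inside
  \<open>I\<close>. The exponent depends on \<open>f\<close> and \<open>g\<close> but is the same
  for all \<open>x\<close> in \<open>cont f\<close>.\<close>

lemma pow_content_smult_mem_ext:
  assumes I: "ideal I R" and f: "f \<in> carrier S" and g: "g \<in> carrier S"
    and fg: "f \<otimes>\<^bsub>S\<^esub> g \<in> ext I"
  obtains n :: nat where "\<And>x. x \<in> cont f \<Longrightarrow> h (x [^] n) \<otimes>\<^bsub>S\<^esub> g \<in> ext I"
proof -
  obtain n :: nat where n: "(cont f [^]\<^bsub>ideals_set R\<^esub> n) \<cdot>\<^bsub>R\<^esub> cont (f \<otimes>\<^bsub>S\<^esub> g)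
      = (cont f [^]\<^bsub>ideals_set R\<^esub> (n + 1)) \<cdot>\<^bsub>R\<^esub> cont g"
    using Dedekind_Mertens[OF f g] by blast
  have "cont (f \<otimes>\<^bsub>S\<^esub> g) \<subseteq> I"
    using mem_ext_iff[OF I] f g fg by simp
  then have sub: "(cont f [^]\<^bsub>ideals_set R\<^esub> (n + 1)) \<cdot>\<^bsub>R\<^esub> cont g \<subseteq> I"
    using R.ideal_prod_inter[OF R.ideal_pow[OF content_ideal[OF f]] content_ideal, of "f \<otimes>\<^bsub>S\<^esub> g" n]
      f g n by auto
  have "h (x [^] (n + 1)) \<otimes>\<^bsub>S\<^esub> g \<in> ext I" if "x \<in> cont f" for x
  proof -
    have "x [^] (n + 1) \<otimes> y \<in> I" if "y \<in> cont g" for y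
      using sub that R.pow_mem_ideal_pow[OF content_ideal[OF f] \<open>x \<in> cont f\<close>]
      by (blast intro: ideal_prod.prod)
    moreover have "x \<in> carrier R"
      using that f by (blast dest: content_ideal ideal.Icarr)
    ultimately show ?thesis
      using smult_mem_ext_iff[OF I _ g] R.nat_pow_closed by blast
  qed
  then show thesis using that by blast
qed

text \<open>If \<open>cont f\<close> has an element \<open>x\<close> outside \<open>p\<close>, then
  a power of \<open>x\<close>, still outside \<open>p\<close>, multiplies \<open>cont g\<close> into
  \<open>p\<close>, which forces \<open>cont g\<close> into \<open>p\<close>.\<close>

lemma ext_primeideal:
  assumes "primeideal p R"
  shows "primeideal (ext p) S"
proof -
  interpret p: primeideal p R by fact
  show ?thesis
  proof (rule primeidealI)
    show "ideal (ext p) S" by (rule ext_ideal[OF p.is_ideal])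
    show "cring S" ..
    \<comment> \<open>Properness of the extension rests on the axiom c(1) = R.\<close>
    have "\<not> cont \<one>\<^bsub>S\<^esub> \<subseteq> p"
      unfolding content_one using p.I_notcarr p.a_subset by blast
    then show "carrier S \<noteq> ext p"
      using mem_ext_iff[OF p.is_ideal S.one_closed] by auto
  next
    fix f g assume f: "f \<in> carrier S" and g: "g \<in> carrier S" and fg: "f \<otimes>\<^bsub>S\<^esub> g \<in> ext p"
    obtain n :: nat where n: "\<And>x. x \<in> cont f \<Longrightarrow> h (x [^] n) \<otimes>\<^bsub>S\<^esub> g \<in> ext p"
      using pow_content_smult_mem_ext[OF p.is_ideal f g fg] by blast
    show "f \<in> ext p \<or> g \<in> ext p"
    proof (cases "cont f \<subseteq> p")
      case True
      then show ?thesis using mem_ext_iff[OF p.is_ideal f] by simp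
    next
      case False
      then obtain x where x: "x \<in> cont f" "x \<notin> p" by blast
      have xR: "x \<in> carrier R"
        using x(1) content_ideal[OF f] by (blast dest: ideal.Icarr)
      have "x [^] n \<notin> p" using p.mem_of_pow_mem[OF xR] x(2) by blast
      moreover have "\<forall>y\<in>cont g. x [^] n \<otimes> y \<in> p"
        using n[OF x(1)] smult_mem_ext_iff[OF p.is_ideal _ g] xR by blast
      ultimately have "cont g \<subseteq> p"
        using p.I_prime xR content_ideal[OF g] by (meson R.nat_pow_closed ideal.Icarr subsetI)
      then show ?thesis using mem_ext_iff[OF p.is_ideal g] by simp
    qed
  qed
qed

section \<open>Transfer of strong Krull primes between \<open>R\<close> and \<open>S\<close>\<close>

lemma ext_mem_strong_Krull:
  assumes I: "ideal I R" and p: "p \<in> strong_Krull R (quot_module R I)"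
  shows "ext p \<in> strong_Krull S (quot_module S (ext I))"
  unfolding S.mem_strong_Krull_quot_module_iff[OF ext_ideal[OF I]]
proof (intro conjI allI impI)
  have prime: "primeideal p R" and W: "\<And>G. finite G \<Longrightarrow> G \<subseteq> p \<Longrightarrow>
      \<exists>x\<in>carrier R. (\<forall>r\<in>G. r \<otimes> x \<in> I) \<and> (\<forall>r\<in>carrier R. r \<otimes> x \<in> I \<longrightarrow> r \<in> p)"
    using p unfolding R.mem_strong_Krull_quot_module_iff[OF I] by auto
  interpret p: primeideal p R by fact
  show "primeideal (ext p) S" by (rule ext_primeideal[OF prime])
  fix F assume F: "finite F \<and> F \<subseteq> ext p"
  then have FS: "F \<subseteq> carrier S"
    using ideal.Icarr[OF ext_ideal[OF p.is_ideal]] by blast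
  \<comment> \<open>Generators of the contents of all \<open>f\<close> in \<open>F\<close> together
    form a finite subset of \<open>p\<close>; a witness \<open>z\<close> for that subset yields the
    witness \<open>h z\<close> for \<open>F\<close>.\<close>
  have "\<exists>G. finite G \<and> G \<subseteq> carrier R \<and> cont f = Idl\<^bsub>R\<^esub> G" if "f \<in> F" for f
    using that FS content_finitely_generated by (metis subsetD)
  then obtain G where G: "\<And>f. f \<in> F \<Longrightarrow> finite (G f)" "\<And>f. f \<in> F \<Longrightarrow> G f \<subseteq> carrier R"
      "\<And>f. f \<in> F \<Longrightarrow> cont f = Idl\<^bsub>R\<^esub> (G f)"
    by metis
  have "G f \<subseteq> p" if "f \<in> F" for f
  proof -
    have "cont f \<subseteq> p"
      using that F FS mem_ext_iff[OF p.is_ideal] by blast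
    then show ?thesis
      using R.genideal_self[OF G(2)[OF that]] G(3)[OF that] by simp
  qed
  then obtain z where z: "z \<in> carrier R" "\<And>f r. f \<in> F \<Longrightarrow> r \<in> G f \<Longrightarrow> r \<otimes> z \<in> I"
      "\<And>r. r \<in> carrier R \<Longrightarrow> r \<otimes> z \<in> I \<Longrightarrow> r \<in> p"
  proof -
    have "finite (\<Union>f\<in>F. G f)" "(\<Union>f\<in>F. G f) \<subseteq> p"
      using F G(1) \<open>\<And>f. f \<in> F \<Longrightarrow> G f \<subseteq> p\<close> by auto
    from W[OF this] show ?thesis using that by blast
  qed
  \<comment> \<open>By \<open>mem_ext_iff\<close> the right side says that \<open>f\<close> lies in
    the extension of (I : z).\<close>
  have colon: "f \<otimes>\<^bsub>S\<^esub> h z \<in> ext I \<longleftrightarrow> cont f \<subseteq> {r \<in> carrier R. r \<otimes> z \<in> I}"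
    if "f \<in> carrier S" for f
    using smult_mem_ext_iff[OF I z(1) that] that z(1) ideal.Icarr[OF content_ideal[OF that]]
    by (auto simp: S.m_comm R.m_comm)
  show "\<exists>x\<in>carrier S. (\<forall>r\<in>F. r \<otimes>\<^bsub>S\<^esub> x \<in> ext I) \<and>
      (\<forall>r\<in>carrier S. r \<otimes>\<^bsub>S\<^esub> x \<in> ext I \<longrightarrow> r \<in> ext p)"
  proof (intro bexI[of _ "h z"] conjI ballI impI)
    fix f assume f: "f \<in> F"
    have "Idl\<^bsub>R\<^esub> (G f) \<subseteq> {r \<in> carrier R. r \<otimes> z \<in> I}"
      using R.ideal_colon[OF I z(1)] z(2)[OF f] G(2)[OF f]
      by (intro R.genideal_minimal) auto
    then show "f \<otimes>\<^bsub>S\<^esub> h z \<in> ext I"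
      using colon f FS G(3) by blast
  next
    fix f assume "f \<in> carrier S" "f \<otimes>\<^bsub>S\<^esub> h z \<in> ext I"
    then show "f \<in> ext p"
      using colon z(3) mem_ext_iff[OF p.is_ideal] by blast
  qed (use z(1) in simp)
qed

text \<open>The equation for \<open>Q\<close> needs witnesses for single elements only; the claim on
  the contraction \<open>p\<close> uses them for arbitrary finite sets.\<close>

lemma strong_Krull_ext_eq_ext:
  assumes I: "ideal I R" and Q: "Q \<in> strong_Krull S (quot_module S (ext I))"
  defines "p \<equiv> {r \<in> carrier R. h r \<in> Q}"
  shows "Q = ext p" "p \<in> strong_Krull R (quot_module R I)"
proof -
  have prime: "primeideal Q S" and W: "\<And>F. finite F \<Longrightarrow> F \<subseteq> Q \<Longrightarrow> \<exists>g\<in>carrier S.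
      (\<forall>f\<in>F. f \<otimes>\<^bsub>S\<^esub> g \<in> ext I) \<and> (\<forall>f\<in>carrier S. f \<otimes>\<^bsub>S\<^esub> g \<in> ext I \<longrightarrow> f \<in> Q)"
    using Q unfolding S.mem_strong_Krull_quot_module_iff[OF ext_ideal[OF I]] by auto
  interpret Q: primeideal Q S by fact
  have prime_p: "primeideal p R"
    using ring.primeideal_vimage[OF R.is_cring prime] unfolding p_def .
  note p_ideal = primeideal.axioms(1)[OF prime_p]
  show "Q = ext p"
  proof
    show "ext p \<subseteq> Q"
      using ext_subset_iff[OF p_ideal Q.is_ideal] by (auto simp: p_def)
    show "Q \<subseteq> ext p"
    proof
      fix f assume f: "f \<in> Q"
      then have fS: "f \<in> carrier S" by (rule Q.Icarr)
      obtain g where g: "g \<in> carrier S" "f \<otimes>\<^bsub>S\<^esub> g \<in> ext I"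
          "\<And>f. f \<in> carrier S \<Longrightarrow> f \<otimes>\<^bsub>S\<^esub> g \<in> ext I \<Longrightarrow> f \<in> Q"
        using W[of "{f}"] f by auto
      obtain n :: nat where n: "\<And>x. x \<in> cont f \<Longrightarrow> h (x [^] n) \<otimes>\<^bsub>S\<^esub> g \<in> ext I"
        using pow_content_smult_mem_ext[OF I fS g(1,2)] by blast
      have "cont f \<subseteq> p"
      proof
        fix x assume x: "x \<in> cont f"
        then have xR: "x \<in> carrier R"
          using content_ideal[OF fS] by (blast dest: ideal.Icarr)
        then have "x [^] n \<in> p"
          using n[OF x] g(3) by (simp add: p_def)
        then show "x \<in> p" by (rule primeideal.mem_of_pow_mem[OF prime_p xR])
      qed
      then show "f \<in> ext p" using mem_ext_iff[OF p_ideal fS] by simp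
    qed
  qed
  show "p \<in> strong_Krull R (quot_module R I)"
    unfolding R.mem_strong_Krull_quot_module_iff[OF I]
  proof (intro conjI allI impI)
    show "primeideal p R" by fact
    fix G assume G: "finite G \<and> G \<subseteq> p"
    then have "finite (h ` G)" "h ` G \<subseteq> Q" by (auto simp: p_def)
    from W[OF this] obtain g where g: "g \<in> carrier S" "\<And>r. r \<in> G \<Longrightarrow> h r \<otimes>\<^bsub>S\<^esub> g \<in> ext I"
        "\<And>f. f \<in> carrier S \<Longrightarrow> f \<otimes>\<^bsub>S\<^esub> g \<in> ext I \<Longrightarrow> f \<in> Q"
      by blast
    obtain Z where Z: "finite Z" "Z \<subseteq> carrier R" "cont g = Idl\<^bsub>R\<^esub> Z"
      using content_finitely_generated[OF g(1)] .
    \<comment> \<open>The elements \<open>y\<close> with \<open>y \<otimes> r \<in> I\<close> form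
      an ideal, so it is enough to test generators of \<open>cont g\<close>.\<close>
    have kill: "h r \<otimes>\<^bsub>S\<^esub> g \<in> ext I \<longleftrightarrow> (\<forall>z\<in>Z. r \<otimes> z \<in> I)" if r: "r \<in> carrier R" for r
    proof -
      have "cont g \<subseteq> {y \<in> carrier R. y \<otimes> r \<in> I} \<longleftrightarrow> Z \<subseteq> {y \<in> carrier R. y \<otimes> r \<in> I}"
        unfolding Z(3) by (rule R.Idl_subset_ideal[OF R.ideal_colon[OF I r] Z(2)])
      then show ?thesis
        using smult_mem_ext_iff[OF I r g(1)] Z(2) r ideal.Icarr[OF content_ideal[OF g(1)]]
        by (simp add: subset_iff Ball_def R.m_comm[OF r])
    qed
    have "\<exists>z\<in>Z. \<forall>r\<in>carrier R. r \<otimes> z \<in> I \<longrightarrow> r \<in> p"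
    proof (rule ccontr)
      assume "\<not> ?thesis"
      then obtain s where s: "\<And>z. z \<in> Z \<Longrightarrow> s z \<in> carrier R - p"
          "\<And>z. z \<in> Z \<Longrightarrow> s z \<otimes> z \<in> I"
        by (metis DiffI)
      \<comment> \<open>The product stays outside the prime \<open>p\<close>, yet each factor
        \<open>s z\<close> puts it into (I : z), so \<open>h t\<close> multiplies \<open>g\<close>
        into \<open>ext I\<close>. For empty \<open>Z\<close> it is \<open>\<one>\<close> and the
        contradiction is the same.\<close>
      define t where "t = (\<Otimes>z\<in>Z. s z)"
      have t: "t \<in> carrier R - p"
        unfolding t_def using Z(1) s(1) by (rule primeideal.prod_not_mem[OF prime_p])
      have "t \<otimes> z \<in> I" if z: "z \<in> Z" for z
      proof -
        define u where "u = (\<Otimes>z\<in>Z - {z}. s z)"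
        have u: "u \<in> carrier R" unfolding u_def using s(1) by (intro R.finprod_closed) auto
        have "insert z (Z - {z}) = Z" using z by blast
        then have "t = s z \<otimes> u"
          using R.finprod_insert[of "Z - {z}" z s] Z(1) s(1) z unfolding t_def u_def by auto
        then have "t \<otimes> z = u \<otimes> (s z \<otimes> z)"
          using u s(1)[OF z] z Z(2) by (auto simp: R.m_ac)
        then show ?thesis using ideal.I_l_closed[OF I s(2)[OF z] u] by simp
      qed
      then have "h t \<in> Q" using kill t g(3) by auto
      then show False using t by (auto simp: p_def)
    qed
    then obtain z where "z \<in> Z" "\<forall>r\<in>carrier R. r \<otimes> z \<in> I \<longrightarrow> r \<in> p" by blast
    moreover have "\<forall>r\<in>G. r \<otimes> z \<in> I"
      using kill g(2) G \<open>z \<in> Z\<close> ideal.Icarr[OF p_ideal] by blast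
    ultimately show "\<exists>x\<in>carrier R. (\<forall>r\<in>G. r \<otimes> x \<in> I) \<and> (\<forall>r\<in>carrier R. r \<otimes> x \<in> I \<longrightarrow> r \<in> p)"
      using Z(2) by blast
  qed
qed

lemma strong_Krull_quot_ext:
  assumes "ideal I R"
  shows "strong_Krull S (quot_module S (ext I)) = ext ` strong_Krull R (quot_module R I)"
  using strong_Krull_ext_eq_ext[OF assms] ext_mem_strong_Krull[OF assms] by blast

end

theorem theorem4p12:
  fixes R :: "('a, 'm) ring_scheme"
    and S :: "('b, 'n) ring_scheme"
    and h :: "'a \<Rightarrow> 'b"
    and \<aa> :: "'a set"
  assumes "content_algebra R S h"
    and "ideal \<aa> R"
  shows "strong_Krull S (quot_module S (ideal_ext S h \<aa>))
           = {ideal_ext S h p | p. p \<in> strong_Krull R (quot_module R \<aa>)}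
       \<and> {ideal_ext S h p | p. p \<in> strong_Krull R (quot_module R \<aa>)}
           = (\<Union>p \<in> strong_Krull R (quot_module R \<aa>).
                strong_Krull S (quot_module S (ideal_ext S h p)))"
proof -
  interpret content_algebra R S h by fact
  \<comment> \<open>The first equality, applied to \<open>p\<close> in place of
    \<open>\<aa>\<close>, reduces this to the strong Krull primes of R/p, where \<open>p\<close> is
    the only one.\<close>
  have "strong_Krull S (quot_module S (ext p)) = {ext p}"
    if "p \<in> strong_Krull R (quot_module R \<aa>)" for p
  proof -
    have p: "primeideal p R"
      using that by (simp add: strong_Krull_def)
    then show ?thesis
      by (simp add: strong_Krull_quot_ext primeideal.axioms(1) R.strong_Krull_quot_primeideal)
  qed
  then show ?thesis
    using strong_Krull_quot_ext[OF assms(2)] by auto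
qed

end
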